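(* Let $f_n:\{0,1\}^{[n]}\to\{-1,1\}$, $n\in\mathbb{N}$, and assume that $I\!I(f_n)\to0$ as $n\to\infty$. Then for any constant $C>0$, if we take $\epsilon_n=C/n^{1/2}$, then $$\lim_{n\to\infty}\mathbb{P}(f_n(\omega)\ne f_n(\omega^{\epsilon_n}))=0 .$$ In particular, this conclusion holds if $\{f_n\}_{n\in\mathbb{N}}$ is monotone and NS.
   Context: $[n]=\{1,\dots,n\}$. $\omega$ is uniform on $\{0,1\}^{[n]}$; for $\epsilon\in(0,1)$, $\omega^\epsilon$ is obtained from $\omega$ by resampling each coordinate (as a fair bit) independently with probability $\epsilon$ (only $n$ large enough that $\epsilon_n<1$ matter). The influence of $i$ on $f$ is $I_i(f)=\mathbb{P}(f(\omega)\ne f(\omega_i))$, where $\omega_i$ is $\omega$ with the $i$th bit flipped, and $I\!I(f):=\sum_{i\in[n]}I_i(f)^2$. $f_n$ is monotone if $f_n(\omega)\le f_n(\omega')$ whenever $\omega_i\le\omega'_i$ for every $i$. $\{f_n\}$ is NS (noise sensitive) if for every $\epsilon\in(0,1)$, $\lim_{n\to\infty}\mathbb{E}[f_n(\omega)f_n(\omega^\epsilon)]-\mathbb{E}[f_n(\omega)]^2=0$. *)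

theory Defs
  imports "HOL-Probability.Probability"
begin

(* A point of {0,1}^[n] is an extensional function on {1..n}, with the bits 0 and 1
   rendered as False and True (so that False < True). *)
definition cube :: "nat \<Rightarrow> (nat \<Rightarrow> bool) set" where
  "cube n = {1..n} \<rightarrow>\<^sub>E UNIV"

definition uniform_cube :: "nat \<Rightarrow> (nat \<Rightarrow> bool) pmf" where
  "uniform_cube n = pmf_of_set (cube n)"

(* The joint law of (\<omega>, \<omega>^\<epsilon>).  Here r i says whether coordinate i is resampled, and
   \<eta> i is the fresh fair bit; \<omega>, r and \<eta> are independent.  Only \<epsilon> in [0,1] is
   meaningful: bernoulli_pmf truncates its argument to this interval. *)
definition noise_pair :: "nat \<Rightarrow> real \<Rightarrow> ((nat \<Rightarrow> bool) \<times> (nat \<Rightarrow> bool)) pmf" where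
  "noise_pair n \<epsilon> = do {
     \<omega> \<leftarrow> uniform_cube n;
     r \<leftarrow> Pi_pmf {1..n} False (\<lambda>_. bernoulli_pmf \<epsilon>);
     \<eta> \<leftarrow> uniform_cube n;
     return_pmf (\<omega>, \<lambda>i\<in>{1..n}. if r i then \<eta> i else \<omega> i)
   }"

definition flip_bit :: "nat \<Rightarrow> (nat \<Rightarrow> bool) \<Rightarrow> (nat \<Rightarrow> bool)" where
  "flip_bit i \<omega> = fun_upd \<omega> i (\<not> \<omega> i)"

definition influence :: "nat \<Rightarrow> ((nat \<Rightarrow> bool) \<Rightarrow> real) \<Rightarrow> nat \<Rightarrow> real" where
  "influence n f i = measure_pmf.prob (uniform_cube n) {\<omega>. f \<omega> \<noteq> f (flip_bit i \<omega>)}"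

definition sum_sq_influence :: "nat \<Rightarrow> ((nat \<Rightarrow> bool) \<Rightarrow> real) \<Rightarrow> real" where
  "sum_sq_influence n f = (\<Sum>i\<in>{1..n}. (influence n f i)\<^sup>2)"

definition monotone_cube :: "nat \<Rightarrow> ((nat \<Rightarrow> bool) \<Rightarrow> real) \<Rightarrow> bool" where
  "monotone_cube n f \<longleftrightarrow>
     (\<forall>\<omega>\<in>cube n. \<forall>\<omega>'\<in>cube n. (\<forall>i\<in>{1..n}. \<omega> i \<le> \<omega>' i) \<longrightarrow> f \<omega> \<le> f \<omega>')"

definition noise_sensitive :: "(nat \<Rightarrow> (nat \<Rightarrow> bool) \<Rightarrow> real) \<Rightarrow> bool" where
  "noise_sensitive f \<longleftrightarrow>
     (\<forall>\<epsilon>\<in>{0<..<1}.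
        (\<lambda>n. measure_pmf.expectation (noise_pair n \<epsilon>) (\<lambda>(\<omega>, \<omega>'). f n \<omega> * f n \<omega>')
             - (measure_pmf.expectation (uniform_cube n) (f n))\<^sup>2) \<longlonglongrightarrow> 0)"

end

theory Submission
  imports Defs
begin

text \<open>
  Write \<open>\<omega>\<^sup>\<epsilon>\<close> as \<open>\<omega>\<close> with the coordinates in a random set \<open>U\<close> replaced by those of an
  independent copy \<open>\<eta>\<close>. Conditionally on \<open>U\<close>, replacing the coordinates one at a time passes
  through uniform configurations only, so \<open>f\<close> changes with probability at most
  \<open>\<Sum>i\<in>U. I\<^sub>i(f)\<close>. Averaging over \<open>U\<close> and using Cauchy--Schwarz gives the bound
  \<open>\<epsilon> \<Sum>i. I\<^sub>i(f) \<le> \<epsilon> \<surd>n \<surd>II(f)\<close>.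
  For monotone \<open>f\<close> the influences are the degree-one Fourier coefficients. Given \<open>U\<close>, the
  expectation of \<open>f(\<omega>) f(\<omega>\<^sup>\<epsilon>)\<close> is the squared norm of the projection of \<open>f\<close> to the functions of
  the coordinates outside \<open>U\<close>, so by Bessel's inequality its average over \<open>U\<close> is at least
  \<open>(E f)\<^sup>2 + (1 - \<epsilon>) II(f)\<close>; hence noise sensitivity forces \<open>II(f) \<longlonglongrightarrow> 0\<close>.
\<close>

declare One_nat_def [simp del]

section \<open>Averages over the cube\<close>

abbreviation mean :: "nat \<Rightarrow> ((nat \<Rightarrow> bool) \<Rightarrow> real) \<Rightarrow> real" where
  "mean n h \<equiv> measure_pmf.expectation (uniform_cube n) h"

text \<open>The restriction to \<open>{1..n}\<close> keeps every value in \<open>cube n\<close>, so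
  \<open>U\<close> can be any set of naturals, such as \<open>{i. r i}\<close>.\<close>

definition mix :: "nat \<Rightarrow> nat set \<Rightarrow> (nat \<Rightarrow> bool) \<Rightarrow> (nat \<Rightarrow> bool) \<Rightarrow> nat \<Rightarrow> bool" where
  "mix n U \<omega> \<eta> = (\<lambda>i\<in>{1..n}. if i \<in> U then \<eta> i else \<omega> i)"

text \<open>The degree-one Walsh character of coordinate \<open>i\<close>, signed so that increasing
  functions have nonnegative correlation with it.\<close>

definition sgn_bit :: "nat \<Rightarrow> (nat \<Rightarrow> bool) \<Rightarrow> real" where
  "sgn_bit i \<omega> = (if \<omega> i then 1 else -1)"

lemma finite_cube [simp]: "finite (cube n)"
  by (simp add: cube_def finite_PiE)

lemma cube_nonempty [simp]: "cube n \<noteq> {}"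
  by (simp add: cube_def PiE_eq_empty_iff)

lemma set_uniform_cube [simp]: "set_pmf (uniform_cube n) = cube n"
  by (simp add: uniform_cube_def)

lemma integrable_uniform_cube [simp]:
  "integrable (measure_pmf (uniform_cube n)) (h :: _ \<Rightarrow> real)"
  by (rule integrable_measure_pmf_finite) simp

lemma mean_eq_sum: "mean n h = (\<Sum>\<omega>\<in>cube n. h \<omega>) / card (cube n)"
  by (simp add: uniform_cube_def integral_pmf_of_set)

lemma mean_cong: "(\<And>\<omega>. \<omega> \<in> cube n \<Longrightarrow> g \<omega> = h \<omega>) \<Longrightarrow> mean n g = mean n h"
  by (simp add: mean_eq_sum)

lemma mean_mono: "(\<And>\<omega>. \<omega> \<in> cube n \<Longrightarrow> g \<omega> \<le> h \<omega>) \<Longrightarrow> mean n g \<le> mean n h"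
  by (simp add: mean_eq_sum divide_right_mono sum_mono)

lemma mix_in_cube [simp]: "mix n U \<omega> \<eta> \<in> cube n"
  by (auto simp: mix_def cube_def)

lemma mix_mix_left: "mix n U (mix n U \<omega> \<zeta>) \<eta> = mix n U \<omega> \<eta>"
  by (auto simp: mix_def)

lemma mix_mix_cancel: "\<omega> \<in> cube n \<Longrightarrow> mix n U (mix n U \<omega> \<eta>) (mix n U \<eta> \<omega>) = \<omega>"
  by (auto simp: mix_def cube_def PiE_iff extensional_def fun_eq_iff)

text \<open>Exchanging the coordinates in \<open>U\<close> between the two configurations is an
  involution of \<open>cube n \<times> cube n\<close>, so it preserves the law of an independent
  uniform pair.\<close>

lemma mean_mix:
  "mean n (\<lambda>\<omega>. mean n (\<lambda>\<eta>. h (mix n U \<omega> \<eta>) (mix n U \<eta> \<omega>))) =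
   mean n (\<lambda>\<omega>. mean n (\<lambda>\<eta>. h \<omega> \<eta>))"
proof -
  have "(\<Sum>(\<omega>, \<eta>)\<in>cube n \<times> cube n. h (mix n U \<omega> \<eta>) (mix n U \<eta> \<omega>)) =
        (\<Sum>(\<omega>, \<eta>)\<in>cube n \<times> cube n. h \<omega> \<eta>)"
    by (rule sum.reindex_bij_witness[where i = "\<lambda>(\<omega>, \<eta>). (mix n U \<omega> \<eta>, mix n U \<eta> \<omega>)"
          and j = "\<lambda>(\<omega>, \<eta>). (mix n U \<omega> \<eta>, mix n U \<eta> \<omega>)"])
       (auto simp: mix_mix_cancel)
  then show ?thesis
    by (simp add: mean_eq_sum sum.cartesian_product flip: sum_divide_distrib)
qed

lemma mean_mix_uniform: "mean n (\<lambda>\<omega>. mean n (\<lambda>\<eta>. h (mix n U \<omega> \<eta>))) = mean n h"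
  using mean_mix[of n "\<lambda>\<omega> \<eta>. h \<omega>" U] by simp

lemma flip_bit_in_cube [simp]: "i \<in> {1..n} \<Longrightarrow> \<omega> \<in> cube n \<Longrightarrow> flip_bit i \<omega> \<in> cube n"
  by (auto simp: flip_bit_def cube_def PiE_iff extensional_def)

lemma flip_bit_flip_bit [simp]: "flip_bit i (flip_bit i \<omega>) = \<omega>"
  by (auto simp: flip_bit_def)

lemma mean_flip_bit:
  assumes "i \<in> {1..n}"
  shows "mean n (\<lambda>\<omega>. h (flip_bit i \<omega>)) = mean n h"
proof -
  have "(\<Sum>\<omega>\<in>cube n. h (flip_bit i \<omega>)) = (\<Sum>\<omega>\<in>cube n. h \<omega>)"
    using assms
    by (intro sum.reindex_bij_witness[where i = "flip_bit i" and j = "flip_bit i"]) auto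
  then show ?thesis
    by (simp add: mean_eq_sum)
qed

section \<open>Averages over the noise\<close>

lemma finite_set_Pi_bernoulli [simp]:
  "finite (set_pmf (Pi_pmf {1..n::nat} False (\<lambda>_. bernoulli_pmf \<epsilon>)))"
  by (rule finite_subset[OF set_Pi_pmf_subset'])
     (auto intro!: finite_PiE_dflt)

lemma integrable_Pi_bernoulli [simp]:
  "integrable (measure_pmf (Pi_pmf {1..n::nat} False (\<lambda>_. bernoulli_pmf \<epsilon>))) (h :: _ \<Rightarrow> real)"
  by (rule integrable_measure_pmf_finite) simp

lemma expectation_bind_pmf_finite:
  fixes h :: "'b \<Rightarrow> real"
  assumes fin: "finite (set_pmf p)" "\<And>x. x \<in> set_pmf p \<Longrightarrow> finite (set_pmf (q x))"
  shows "measure_pmf.expectation (bind_pmf p q) h =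
         measure_pmf.expectation p (\<lambda>x. measure_pmf.expectation (q x) h)"
proof -
  have "measure_pmf.expectation (bind_pmf p q) h =
      (\<Sum>x\<in>set_pmf p. pmf p x *\<^sub>R measure_pmf.expectation (q x) h)"
    using fin by (intro pmf_expectation_bind) auto
  also have "\<dots> = measure_pmf.expectation p (\<lambda>x. measure_pmf.expectation (q x) h)"
    using fin by (subst integral_measure_pmf[where A = "set_pmf p"]) auto
  finally show ?thesis .
qed

text \<open>The resampling pattern is independent of both configurations, so it may be drawn first;
  given the pattern, the resampled set is fixed.\<close>

lemma expectation_noise_pair:
  "measure_pmf.expectation (noise_pair n \<epsilon>) h =
   measure_pmf.expectation (Pi_pmf {1..n} False (\<lambda>_. bernoulli_pmf \<epsilon>))
     (\<lambda>r. mean n (\<lambda>\<omega>. mean n (\<lambda>\<eta>. h (\<omega>, mix n {i. r i} \<omega> \<eta>))))"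
  (is "_ = measure_pmf.expectation ?R _")
proof -
  have *: "noise_pair n \<epsilon> = bind_pmf ?R (\<lambda>r. bind_pmf (uniform_cube n)
     (\<lambda>\<omega>. bind_pmf (uniform_cube n) (\<lambda>\<eta>. return_pmf (\<omega>, mix n {i. r i} \<omega> \<eta>))))"
    unfolding noise_pair_def by (subst bind_commute_pmf) (simp add: mix_def)
  show ?thesis
    unfolding * by (simp add: expectation_bind_pmf_finite)
qed

lemma expectation_resampled:
  assumes "i \<in> {1..n::nat}" "\<epsilon> \<in> {0..1}"
  shows "measure_pmf.expectation (Pi_pmf {1..n} False (\<lambda>_. bernoulli_pmf \<epsilon>))
           (\<lambda>r. if r i then x else y) = \<epsilon> * x + (1 - \<epsilon>) * y"
proof -
  have "measure_pmf.expectation (map_pmf (\<lambda>r. r i) (Pi_pmf {1..n} False (\<lambda>_. bernoulli_pmf \<epsilon>)))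
          (\<lambda>b. if b then x else y) = \<epsilon> * x + (1 - \<epsilon>) * y"
    using assms by (subst Pi_pmf_component) auto
  then show ?thesis
    by simp
qed

section \<open>Noise stability from small influences\<close>

lemma influence_eq_mean:
  "influence n f i = mean n (\<lambda>\<omega>. of_bool (f \<omega> \<noteq> f (flip_bit i \<omega>)))"
proof -
  have "(\<lambda>\<omega>. of_bool (f \<omega> \<noteq> f (flip_bit i \<omega>))) =
      (indicator {\<omega>. f \<omega> \<noteq> f (flip_bit i \<omega>)} :: _ \<Rightarrow> real)"
    by (simp add: fun_eq_iff indicator_def)
  then show ?thesis
    by (simp add: influence_def)
qed

text \<open>Enlarging \<open>U\<close> by \<open>i\<close> can alter only the value at
  \<open>i\<close>, and a bit has just one other value.\<close>

lemma mix_insert: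
  "i \<in> {1..n} \<Longrightarrow> mix n (insert i U) \<omega> \<eta> \<in> {mix n U \<omega> \<eta>, flip_bit i (mix n U \<omega> \<eta>)}"
  by (cases "mix n U \<omega> \<eta> i = \<eta> i") (auto simp: mix_def flip_bit_def fun_eq_iff)

lemma mix_empty: "\<omega> \<in> cube n \<Longrightarrow> mix n {} \<omega> \<eta> = \<omega>"
  by (auto simp: mix_def cube_def PiE_iff extensional_def fun_eq_iff)

lemma disagreement_mix_le:
  assumes "finite U" "U \<subseteq> {1..n}"
  shows "mean n (\<lambda>\<omega>. mean n (\<lambda>\<eta>. of_bool (f \<omega> \<noteq> f (mix n U \<omega> \<eta>)))) \<le> (\<Sum>i\<in>U. influence n f i)"
  using assms
proof (induction U)
  case empty
  then show ?case
    by (simp add: mean_eq_sum mix_empty)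
next
  case (insert i U)
  have step: "of_bool (f \<omega> \<noteq> f (mix n (insert i U) \<omega> \<eta>)) \<le>
      (of_bool (f \<omega> \<noteq> f (mix n U \<omega> \<eta>)) +
       of_bool (f (mix n U \<omega> \<eta>) \<noteq> f (flip_bit i (mix n U \<omega> \<eta>))) :: real)" for \<omega> \<eta>
    using insert.prems mix_insert[of i n U \<omega> \<eta>] by auto
  have "mean n (\<lambda>\<omega>. mean n (\<lambda>\<eta>. of_bool (f \<omega> \<noteq> f (mix n (insert i U) \<omega> \<eta>)))) \<le>
        mean n (\<lambda>\<omega>. mean n (\<lambda>\<eta>. of_bool (f \<omega> \<noteq> f (mix n U \<omega> \<eta>)) +
           of_bool (f (mix n U \<omega> \<eta>) \<noteq> f (flip_bit i (mix n U \<omega> \<eta>)))))"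
    by (intro mean_mono step)
  \<comment> \<open>The intermediate configuration \<open>mix n U \<omega> \<eta>\<close> is
    uniform, so its flip at \<open>i\<close> changes \<open>f\<close> with probability exactly
    \<open>influence n f i\<close>.\<close>
  also have "\<dots> = mean n (\<lambda>\<omega>. mean n (\<lambda>\<eta>. of_bool (f \<omega> \<noteq> f (mix n U \<omega> \<eta>)))) + influence n f i"
    by (simp add: influence_eq_mean
          mean_mix_uniform[of n "\<lambda>\<omega>. of_bool (f \<omega> \<noteq> f (flip_bit i \<omega>))"])
  finally show ?case
    using insert by simp
qed

lemma disagreement_noise_le:
  assumes "\<epsilon> \<in> {0..1}"
  shows "measure_pmf.prob (noise_pair n \<epsilon>) {(\<omega>, \<omega>'). f \<omega> \<noteq> f \<omega>'} \<le>
         \<epsilon> * (\<Sum>i\<in>{1..n}. influence n f i)"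
proof -
  let ?R = "Pi_pmf {1..n} False (\<lambda>_. bernoulli_pmf \<epsilon>)"
  let ?E = "{(\<omega>, \<omega>'). f \<omega> \<noteq> f \<omega>'}"
  have "measure_pmf.prob (noise_pair n \<epsilon>) ?E =
      measure_pmf.expectation (noise_pair n \<epsilon>) (indicator ?E)"
    by simp
  also have "\<dots> = measure_pmf.expectation ?R
      (\<lambda>r. mean n (\<lambda>\<omega>. mean n (\<lambda>\<eta>. of_bool (f \<omega> \<noteq> f (mix n {i. r i} \<omega> \<eta>)))))"
    unfolding expectation_noise_pair by (simp add: indicator_def)
  also have "\<dots> \<le> measure_pmf.expectation ?R
      (\<lambda>r. \<Sum>i\<in>{1..n}. if r i then influence n f i else 0)"
  proof (intro integral_mono_AE AE_pmfI)
    fix r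
    \<comment> \<open>Indices outside \<open>{1..n}\<close> do not affect \<open>mix n\<close>;
      dropping them gives the finite set that the induction bound requires.\<close>
    let ?U = "{i\<in>{1..n}. r i}"
    have "mix n {i. r i} = mix n ?U"
      by (auto simp: mix_def fun_eq_iff)
    then have "mean n (\<lambda>\<omega>. mean n (\<lambda>\<eta>. of_bool (f \<omega> \<noteq> f (mix n {i. r i} \<omega> \<eta>)))) \<le>
        (\<Sum>i\<in>?U. influence n f i)"
      using disagreement_mix_le[of ?U n f, OF _ Collect_restrict] by simp
    also have "\<dots> = (\<Sum>i\<in>{1..n}. if r i then influence n f i else 0)"
      by (rule sum.inter_filter) simp
    finally show "mean n (\<lambda>\<omega>. mean n (\<lambda>\<eta>. of_bool (f \<omega> \<noteq> f (mix n {i. r i} \<omega> \<eta>)))) \<le>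
        (\<Sum>i\<in>{1..n}. if r i then influence n f i else 0)" .
  qed simp_all
  also have "\<dots> = \<epsilon> * (\<Sum>i\<in>{1..n}. influence n f i)"
    using assms by (simp add: expectation_resampled sum_distrib_left del: atLeastAtMost_iff cong: sum.cong)
  finally show ?thesis .
qed

text \<open>Cauchy-Schwarz against the constant vector 1, whose norm \<open>sqrt n\<close> is what
  sets the noise scale \<open>C / sqrt n\<close>.\<close>

lemma sum_influence_le:
  "(\<Sum>i\<in>{1..n}. influence n f i) \<le> sqrt n * sqrt (sum_sq_influence n f)"
proof -
  have "(\<Sum>i\<in>{1..n}. 1 * influence n f i)\<^sup>2 \<le>
        (\<Sum>i\<in>{1..n}. 1\<^sup>2) * (\<Sum>i\<in>{1..n}. (influence n f i)\<^sup>2)"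
    by (rule Cauchy_Schwarz_ineq_sum)
  then have "(\<Sum>i\<in>{1..n}. influence n f i)\<^sup>2 \<le> n * sum_sq_influence n f"
    by (simp add: sum_sq_influence_def)
  then show ?thesis
    by (metis real_le_rsqrt real_sqrt_mult)
qed

lemma noise_stable_if_small_influences:
  assumes lim: "(\<lambda>n. sum_sq_influence n (f n)) \<longlonglongrightarrow> 0" and "C > 0"
  shows "(\<lambda>n. measure_pmf.prob (noise_pair n (C / sqrt (real n)))
            {(\<omega>, \<omega>'). f n \<omega> \<noteq> f n \<omega>'}) \<longlonglongrightarrow> 0"
proof (rule tendsto_sandwich[OF _ _ tendsto_const])
  show "(\<lambda>n. C * sqrt (sum_sq_influence n (f n))) \<longlonglongrightarrow> 0"
    using tendsto_mult_left[OF tendsto_real_sqrt[OF lim], of C] by simp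
  show "\<forall>\<^sub>F n in sequentially. measure_pmf.prob (noise_pair n (C / sqrt (real n)))
      {(\<omega>, \<omega>'). f n \<omega> \<noteq> f n \<omega>'} \<le> C * sqrt (sum_sq_influence n (f n))"
    \<comment> \<open>The condition \<open>n \<ge> C\<^sup>2\<close> puts the noise level in
      \<open>{0..1}\<close>; \<open>n > 0\<close> lets the two factors \<open>sqrt n\<close>
      cancel.\<close>
    using eventually_ge_at_top[of "nat \<lceil>C\<^sup>2\<rceil>"] eventually_gt_at_top[of 0]
  proof eventually_elim
    case (elim n)
    have "C \<le> sqrt n"
      using elim by (intro real_le_rsqrt) linarith
    with elim \<open>C > 0\<close> have \<epsilon>: "C / sqrt n \<in> {0..1}"
      by simp
    have "measure_pmf.prob (noise_pair n (C / sqrt n)) {(\<omega>, \<omega>'). f n \<omega> \<noteq> f n \<omega>'} \<le>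
        C / sqrt n * (\<Sum>i\<in>{1..n}. influence n (f n) i)"
      by (rule disagreement_noise_le[OF \<epsilon>])
    also have "\<dots> \<le> C / sqrt n * (sqrt n * sqrt (sum_sq_influence n (f n)))"
      using \<open>C > 0\<close> by (intro mult_left_mono sum_influence_le) simp
    finally show ?case
      using elim by simp
  qed
qed simp

section \<open>Influences of monotone noise sensitive functions\<close>

lemma sgn_bit_flip_bit [simp]:
  "sgn_bit j (flip_bit i \<omega>) = (if i = j then - sgn_bit j \<omega> else sgn_bit j \<omega>)"
  by (simp add: sgn_bit_def flip_bit_def)

lemma mean_sgn_bit: "i \<in> {1..n} \<Longrightarrow> mean n (sgn_bit i) = 0"
  using mean_flip_bit[of i n "sgn_bit i"] by simp

text \<open>For distinct coordinates, flipping bit \<open>i\<close> negates the product but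
  preserves its mean, which is therefore 0.\<close>

lemma mean_sgn_bit_mult:
  assumes "i \<in> {1..n}"
  shows "mean n (\<lambda>\<omega>. sgn_bit i \<omega> * sgn_bit j \<omega>) = of_bool (i = j)"
proof (cases "i = j")
  case True
  then have "sgn_bit i \<omega> * sgn_bit j \<omega> = 1" for \<omega>
    by (simp add: sgn_bit_def)
  with True show ?thesis
    by simp
next
  case False
  then show ?thesis
    using mean_flip_bit[OF assms, of "\<lambda>\<omega>. sgn_bit i \<omega> * sgn_bit j \<omega>"] by simp
qed

text \<open>By monotonicity, the change of \<open>f\<close> under a flip at \<open>i\<close> has the
  sign of the bit, and where it is nonzero it has size 2, the gap between the values -1 and
  1.\<close>

lemma influence_eq_fourier:
  assumes "monotone_cube n f" and f: "\<And>\<omega>. \<omega> \<in> cube n \<Longrightarrow> f \<omega> \<in> {-1, 1}" and i: "i \<in> {1..n}"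
  shows "influence n f i = mean n (\<lambda>\<omega>. f \<omega> * sgn_bit i \<omega>)"
proof -
  have "2 * of_bool (f \<omega> \<noteq> f (flip_bit i \<omega>)) = f \<omega> * sgn_bit i \<omega> - f (flip_bit i \<omega>) * sgn_bit i \<omega>"
    if \<omega>: "\<omega> \<in> cube n" for \<omega>
  proof -
    have flip: "flip_bit i \<omega> \<in> cube n"
      using i \<omega> by (rule flip_bit_in_cube)
    have "if \<omega> i then f (flip_bit i \<omega>) \<le> f \<omega> else f \<omega> \<le> f (flip_bit i \<omega>)"
      using assms(1) \<omega> flip by (auto simp: monotone_cube_def flip_bit_def)
    then show ?thesis
      using f[OF \<omega>] f[OF flip] by (auto simp: sgn_bit_def split: if_splits)
  qed
  then have "mean n (\<lambda>\<omega>. 2 * of_bool (f \<omega> \<noteq> f (flip_bit i \<omega>))) =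
      mean n (\<lambda>\<omega>. f \<omega> * sgn_bit i \<omega> - f (flip_bit i \<omega>) * sgn_bit i \<omega>)"
    by (rule mean_cong)
  then have "2 * influence n f i =
      mean n (\<lambda>\<omega>. f \<omega> * sgn_bit i \<omega>) - mean n (\<lambda>\<omega>. f (flip_bit i \<omega>) * sgn_bit i \<omega>)"
    by (simp add: influence_eq_mean)
  \<comment> \<open>Substituting the flipped configuration turns the subtracted mean into minus the
    first one, so the difference is twice the coefficient.\<close>
  then show ?thesis
    using mean_flip_bit[OF i, of "\<lambda>\<omega>. f \<omega> * sgn_bit i \<omega>"] by simp
qed

lemma correlation_mix_ge:
  fixes n :: nat and f :: "(nat \<Rightarrow> bool) \<Rightarrow> real"
  defines "a \<equiv> mean n f" and "b \<equiv> \<lambda>i. mean n (\<lambda>\<omega>. f \<omega> * sgn_bit i \<omega>)"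
  shows "a\<^sup>2 + (\<Sum>i\<in>{1..n} - U. (b i)\<^sup>2) \<le> mean n (\<lambda>\<omega>. mean n (\<lambda>\<eta>. f \<omega> * f (mix n U \<omega> \<eta>)))"
proof -
  define V where "V = {1..n} - U"
  \<comment> \<open>\<open>g\<close> is the conditional expectation of \<open>f\<close> given the
    coordinates outside \<open>U\<close>; \<open>L\<close> is the part of its Fourier expansion of
    degree at most one, and \<open>s\<close> the squared norm of \<open>L\<close>.\<close>
  define g where "g \<omega> = mean n (\<lambda>\<eta>. f (mix n U \<omega> \<eta>))" for \<omega>
  define L where "L \<omega> = a + (\<Sum>i\<in>V. b i * sgn_bit i \<omega>)" for \<omega>
  define s where "s = a\<^sup>2 + (\<Sum>i\<in>V. (b i)\<^sup>2)"
  have L_mix: "L (mix n U \<omega> \<eta>) = L \<omega>" for \<omega> \<eta>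
    by (auto simp: L_def V_def sgn_bit_def mix_def intro!: sum.cong)
  have mean_L: "mean n (\<lambda>\<omega>. h \<omega> * L \<omega>) =
      a * mean n h + (\<Sum>i\<in>V. b i * mean n (\<lambda>\<omega>. h \<omega> * sgn_bit i \<omega>))" for h
    by (simp add: L_def distrib_left sum_distrib_left mult.left_commute mult.commute[of _ a])
  have fL: "mean n (\<lambda>\<omega>. f \<omega> * L \<omega>) = s"
    by (simp add: mean_L s_def power2_eq_square a_def b_def)
  have "mean n L = a"
    by (simp add: L_def[abs_def] a_def mean_sgn_bit V_def)
  moreover have "mean n (\<lambda>\<omega>. L \<omega> * sgn_bit i \<omega>) = b i" if "i \<in> V" for i
  proof -
    have "mean n (\<lambda>\<omega>. sgn_bit i \<omega> * L \<omega>) = (\<Sum>j\<in>V. b j * of_bool (i = j))"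
      using that by (simp add: mean_L mean_sgn_bit mean_sgn_bit_mult V_def)
    also have "\<dots> = b i"
      using that by (simp add: V_def)
    finally show ?thesis
      by (simp add: mult.commute)
  qed
  ultimately have LL: "mean n (\<lambda>\<omega>. L \<omega> * L \<omega>) = s"
    by (simp add: mean_L s_def power2_eq_square)
  \<comment> \<open>Since \<open>L\<close> ignores the coordinates in \<open>U\<close>, averaging
    over them does not change the inner product with \<open>L\<close>.\<close>
  have "mean n (\<lambda>\<omega>. g \<omega> * L \<omega>) = mean n (\<lambda>\<omega>. mean n (\<lambda>\<eta>. f (mix n U \<omega> \<eta>) * L (mix n U \<omega> \<eta>)))"
    by (simp add: g_def L_mix)
  also have "\<dots> = s"
    using mean_mix_uniform[of n "\<lambda>\<omega>. f \<omega> * L \<omega>"] fL by simp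
  finally have gL: "mean n (\<lambda>\<omega>. g \<omega> * L \<omega>) = s" .
  \<comment> \<open>Bessel's inequality: \<open>g - L\<close> is orthogonal to
    \<open>L\<close>.\<close>
  have "0 \<le> mean n (\<lambda>\<omega>. (g \<omega> - L \<omega>)\<^sup>2)"
    by simp
  also have "\<dots> = mean n (\<lambda>\<omega>. g \<omega> * g \<omega> - 2 * (g \<omega> * L \<omega>) + L \<omega> * L \<omega>)"
    by (simp add: power2_eq_square algebra_simps)
  also have "\<dots> = mean n (\<lambda>\<omega>. g \<omega> * g \<omega>) - s"
    by (simp add: gL LL)
  finally have "s \<le> mean n (\<lambda>\<omega>. g \<omega> * g \<omega>)"
    by simp
  have g_mix: "g (mix n U \<omega> \<eta>) = g \<omega>" for \<omega> \<eta>
    by (simp add: g_def mix_mix_left)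
  \<comment> \<open>The averaging operator is a self-adjoint projection, so the squared norm of
    \<open>g\<close> is its inner product with \<open>f\<close>.\<close>
  have "mean n (\<lambda>\<omega>. g \<omega> * g \<omega>) = mean n (\<lambda>\<omega>. mean n (\<lambda>\<eta>. f (mix n U \<omega> \<eta>) * g (mix n U \<omega> \<eta>)))"
    unfolding g_mix by (simp add: g_def)
  also have "\<dots> = mean n (\<lambda>\<omega>. mean n (\<lambda>\<eta>. f \<omega> * f (mix n U \<omega> \<eta>)))"
    using mean_mix_uniform[of n "\<lambda>\<omega>. f \<omega> * g \<omega>"] by (simp add: g_def)
  finally show ?thesis
    using \<open>s \<le> _\<close> by (simp add: s_def V_def)
qed

text \<open>Each coordinate escapes resampling with probability \<open>1 - \<epsilon>\<close>, and
  then its squared coefficient counts in \<open>correlation_mix_ge\<close>.\<close>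

lemma correlation_noise_ge:
  assumes "\<epsilon> \<in> {0..1}"
  shows "(mean n f)\<^sup>2 + (1 - \<epsilon>) * (\<Sum>i\<in>{1..n}. (mean n (\<lambda>\<omega>. f \<omega> * sgn_bit i \<omega>))\<^sup>2) \<le>
         measure_pmf.expectation (noise_pair n \<epsilon>) (\<lambda>(\<omega>, \<omega>'). f \<omega> * f \<omega>')"
proof -
  let ?R = "Pi_pmf {1..n} False (\<lambda>_. bernoulli_pmf \<epsilon>)"
  define b where "b i = mean n (\<lambda>\<omega>. f \<omega> * sgn_bit i \<omega>)" for i
  have "(mean n f)\<^sup>2 + (1 - \<epsilon>) * (\<Sum>i\<in>{1..n}. (b i)\<^sup>2) =
      measure_pmf.expectation ?R (\<lambda>r. (mean n f)\<^sup>2 + (\<Sum>i\<in>{1..n}. if r i then 0 else (b i)\<^sup>2))"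
    using assms by (simp add: expectation_resampled sum_distrib_left del: atLeastAtMost_iff cong: sum.cong)
  also have "\<dots> \<le> measure_pmf.expectation ?R
      (\<lambda>r. mean n (\<lambda>\<omega>. mean n (\<lambda>\<eta>. f \<omega> * f (mix n {i. r i} \<omega> \<eta>))))"
  proof (intro integral_mono_AE AE_pmfI)
    fix r :: "nat \<Rightarrow> bool"
    have "(\<Sum>i\<in>{1..n}. if r i then 0 else (b i)\<^sup>2) = (\<Sum>i\<in>{1..n} - {i. r i}. (b i)\<^sup>2)"
      by (intro sum.mono_neutral_cong_right) auto
    then show "(mean n f)\<^sup>2 + (\<Sum>i\<in>{1..n}. if r i then 0 else (b i)\<^sup>2) \<le>
        mean n (\<lambda>\<omega>. mean n (\<lambda>\<eta>. f \<omega> * f (mix n {i. r i} \<omega> \<eta>)))"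
      using correlation_mix_ge[of n f "{i. r i}"] by (simp add: b_def)
  qed simp_all
  finally show ?thesis
    by (simp add: expectation_noise_pair b_def)
qed

lemma small_influences_if_monotone_noise_sensitive:
  assumes f: "\<And>n \<omega>. n \<ge> 1 \<Longrightarrow> \<omega> \<in> cube n \<Longrightarrow> f n \<omega> \<in> {-1, 1}"
    and mono: "\<And>n. n \<ge> 1 \<Longrightarrow> monotone_cube n (f n)" and "noise_sensitive f"
  shows "(\<lambda>n. sum_sq_influence n (f n)) \<longlonglongrightarrow> 0"
proof (rule tendsto_sandwich[OF _ _ tendsto_const])
  \<comment> \<open>A single noise level suffices; at \<open>1/2\<close> the factor
    \<open>1 / (1 - \<epsilon>)\<close> equals 2.\<close>
  let ?cov = "\<lambda>n. measure_pmf.expectation (noise_pair n (1/2)) (\<lambda>(\<omega>, \<omega>'). f n \<omega> * f n \<omega>') -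
    (mean n (f n))\<^sup>2"
  have "?cov \<longlonglongrightarrow> 0"
    using \<open>noise_sensitive f\<close> unfolding noise_sensitive_def by (rule bspec) simp
  from tendsto_mult_left[OF this, of 2] show "(\<lambda>n. 2 * ?cov n) \<longlonglongrightarrow> 0"
    by simp
  show "\<forall>\<^sub>F n in sequentially. sum_sq_influence n (f n) \<le> 2 * ?cov n"
    using eventually_ge_at_top[of 1]
  proof eventually_elim
    case (elim n)
    have "sum_sq_influence n (f n) = (\<Sum>i\<in>{1..n}. (mean n (\<lambda>\<omega>. f n \<omega> * sgn_bit i \<omega>))\<^sup>2)"
      unfolding sum_sq_influence_def
      using influence_eq_fourier[OF mono f] elim by (intro sum.cong) auto
    then show ?case
      using correlation_noise_ge[of "1/2" n "f n"] by simp
  qed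
qed (simp add: sum_sq_influence_def sum_nonneg)

theorem proposition1p25:
  fixes f :: "nat \<Rightarrow> (nat \<Rightarrow> bool) \<Rightarrow> real"
  assumes "\<And>n \<omega>. n \<ge> 1 \<Longrightarrow> \<omega> \<in> cube n \<Longrightarrow> f n \<omega> \<in> {-1, 1}"
  shows "((\<lambda>n. sum_sq_influence n (f n)) \<longlonglongrightarrow> 0 \<longrightarrow>
           (\<forall>C>0. (\<lambda>n. measure_pmf.prob (noise_pair n (C / sqrt (real n)))
                          {(\<omega>, \<omega>'). f n \<omega> \<noteq> f n \<omega>'}) \<longlonglongrightarrow> 0))
       \<and> ((\<forall>n\<ge>1. monotone_cube n (f n)) \<and> noise_sensitive f \<longrightarrow>
           (\<forall>C>0. (\<lambda>n. measure_pmf.prob (noise_pair n (C / sqrt (real n)))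
                          {(\<omega>, \<omega>'). f n \<omega> \<noteq> f n \<omega>'}) \<longlonglongrightarrow> 0))"
  using noise_stable_if_small_influences small_influences_if_monotone_noise_sensitive[of f] assms
  by blast

end
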